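(* Let $1\le m<n$ be integers, let $T$ be a real $(n\times m)$-matrix of full rank $m$ such that $\frac{1}{n\nu_n}\int_{S^{n-1}}\|T^t\eta\|^2\,d\eta=1$, let $\mu\geq 0$, let $s$ be a real number, and let $U$ be the solution of $\mathcal{L}U+\mu U=F$, that is, $\widehat{U}(\omega)=\widehat{F}(\omega)/(\|T^t\omega\|^2+\mu)$. Let $0<\delta<1$, $a=\delta$, $b=\|T^t\|^2$, and $\kappa=b/a$, and let $$P_k(\lambda)=T_k\bigg(\frac{b+a-2\lambda}{b-a}\bigg)\bigg/T_k\bigg(\frac{b+a}{b-a}\bigg)$$ be the Chebyshev polynomial $T_k$ of the first kind of degree $k$ transformed to the interval $a\leq\lambda\leq b$. Let $U_k$ be given by $$(\widehat{U}-\widehat{U}_k)(\omega)=P_k\big(\alpha(\omega)(\|T^t\omega\|^2+\mu)\big)\,\widehat{U}(\omega),\quad \alpha(\omega)=\frac{1}{\|\omega\|^2+\mu}.$$ Then the norm of the iteration error satisfies the estimate $$\|U-U_k\|_s\leq\frac{2q^k}{1+q^{2k}}\,\|U\|_s+\|U-U_\delta\|_s,\quad q=\frac{\sqrt{\kappa}-1}{\sqrt{\kappa}+1},$$ where $\widehat{U}_\delta$ takes the same values as $\widehat{U}$ on the set of all $\omega$ for which $\|T^t\omega\|^2>\delta\|\omega\|^2$ holds and vanishes outside this set.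
   Context: $\|\cdot\|$ (on vectors) is the Euclidean norm, $T^t$ the transpose of $T$, $\|T^t\|$ its spectral norm, $S^{n-1}$ the unit sphere of $\mathbb{R}^n$ with surface measure $d\eta$, $\nu_n$ the volume of the unit ball of $\mathbb{R}^n$. All functions $U:\mathbb{R}^n\to\mathbb{R}$ considered possess the representation $U(y)=(2\pi)^{-n/2}\int\widehat{U}(\omega)e^{i\omega\cdot y}\,d\omega$ with an integrable function $\widehat{U}$, their Fourier transform. $\mathcal{L}$ is the operator given by $(\mathcal{L}U)(y)=(2\pi)^{-n/2}\int\|T^t\omega\|^2\widehat{U}(\omega)e^{i\omega\cdot y}\,d\omega$. The right-hand side $F:\mathbb{R}^n\to\mathbb{R}$ has an integrable Fourier transform $\widehat{F}$, and in the case $\mu=0$ the function $\omega\mapsto\widehat{F}(\omega)/\|T^t\omega\|^2$ is assumed to be integrable. For real $s$, the norm is $\|U\|_s=\int_{\mathbb{R}^n}\|T^t\omega\|^s\,|\widehat{U}(\omega)|\,d\omega$ (with values in $[0,\infty]$). *)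

theory Defs
  imports "HOL-Analysis.Analysis" "HOL-Computational_Algebra.Polynomial"
begin

subsection \<open>Fourier representation\<close>

definition inverse_fourier :: "(real^'n \<Rightarrow> complex) \<Rightarrow> real^'n \<Rightarrow> complex" where
  "inverse_fourier V y =
     complex_of_real ((2 * pi) powr (- real CARD('n) / 2)) *
       (LINT \<omega>|lborel. V \<omega> * exp (\<i> * complex_of_real (\<omega> \<bullet> y)))"

definition is_fourier_transform :: "(real^'n \<Rightarrow> real) \<Rightarrow> (real^'n \<Rightarrow> complex) \<Rightarrow> bool" where
  "is_fourier_transform U V \<longleftrightarrow>
     integrable lborel V \<and> (\<forall>y. complex_of_real (U y) = inverse_fourier V y)"

definition representable :: "(real^'n \<Rightarrow> real) \<Rightarrow> bool" where
  "representable U \<longleftrightarrow> (\<exists>V. is_fourier_transform U V)"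

text \<open>The integrable function representing \<open>U\<close> is determined by \<open>U\<close> only up to a null set,
  so identities between Fourier transforms are to be stated almost everywhere.\<close>

definition fourier :: "(real^'n \<Rightarrow> real) \<Rightarrow> real^'n \<Rightarrow> complex" where
  "fourier U = (SOME V. is_fourier_transform U V)"

subsection \<open>The operator, its equation, and the norms\<close>

definition op_L :: "real^'m^'n \<Rightarrow> (real^'n \<Rightarrow> real) \<Rightarrow> real^'n \<Rightarrow> complex" where
  "op_L T U =
     inverse_fourier (\<lambda>\<omega>. complex_of_real ((norm (transpose T *v \<omega>))\<^sup>2) * fourier U \<omega>)"

text \<open>Where \<open>\<parallel>T\<^sup>t\<omega>\<parallel>\<^sup>2 + \<mu> = 0\<close> the quotient below is \<open>0\<close>; for \<open>T \<noteq> 0\<close> this is a null set.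
  The equation in the second conjunct is a consequence of the other two conjuncts whenever
  the right-hand side is as required (lemma \<open>solution_imp_equation\<close>).\<close>

definition is_solution ::
    "real^'m^'n \<Rightarrow> real \<Rightarrow> (real^'n \<Rightarrow> real) \<Rightarrow> (real^'n \<Rightarrow> real) \<Rightarrow> bool" where
  "is_solution T \<mu> F U \<longleftrightarrow>
     representable U \<and>
     (\<forall>y. op_L T U y + complex_of_real (\<mu> * U y) = complex_of_real (F y)) \<and>
     (AE \<omega> in lborel.
        fourier U \<omega> = fourier F \<omega> / complex_of_real ((norm (transpose T *v \<omega>))\<^sup>2 + \<mu>))"

text \<open>With \<open>powr\<close> the weight is \<open>0\<close> where \<open>T\<^sup>t\<omega> = 0\<close>, for every \<open>s\<close>. For \<open>T \<noteq> 0\<close> this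
  concerns only a null set and does not affect the integral.\<close>

definition snorm :: "real^'m^'n \<Rightarrow> real \<Rightarrow> (real^'n \<Rightarrow> real) \<Rightarrow> ennreal" where
  "snorm T s U =
     (\<integral>\<^sup>+\<omega>. ennreal (norm (transpose T *v \<omega>) powr s * cmod (fourier U \<omega>)) \<partial>lborel)"

subsection \<open>Surface measure on the unit sphere\<close>

text \<open>The surface measure of \<open>A \<subseteq> S\<^sup>n\<^sup>-\<^sup>1\<close> is \<open>n\<close> times the volume of the cone
  \<open>{t x | 0 < t < 1, x \<in> A}\<close> (polar coordinates; lemma \<open>emeasure_surface_measure\<close>).\<close>

definition surface_measure :: "(real^'n) measure" where
  "surface_measure =
     scale_measure (of_nat CARD('n))
       (distr (restrict_space lborel (ball 0 1 - {0})) (restrict_space borel (sphere 0 1))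
          (\<lambda>x. x /\<^sub>R norm x))"

subsection \<open>Chebyshev polynomials\<close>

fun chebyshev :: "nat \<Rightarrow> real poly" where
  "chebyshev 0 = 1"
| "chebyshev (Suc 0) = [:0, 1:]"
| "chebyshev (Suc (Suc k)) = [:0, 2:] * chebyshev (Suc k) - chebyshev k"

definition chebyshev_on :: "real \<Rightarrow> real \<Rightarrow> nat \<Rightarrow> real \<Rightarrow> real" where
  "chebyshev_on a b k l =
     poly (chebyshev k) ((b + a - 2 * l) / (b - a)) / poly (chebyshev k) ((b + a) / (b - a))"

subsection \<open>Consistency of the definitions\<close>

lemma chebyshev_cos: "poly (chebyshev k) (cos t) = cos (real k * t)"
proof (induction k rule: chebyshev.induct)
  case (3 k)
  have "cos (real (Suc (Suc k)) * t) + cos (real k * t) = 2 * cos t * cos (real (Suc k) * t)"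
    using cos_add[of "real (Suc k) * t" t] cos_diff[of "real (Suc k) * t" t]
    by (simp add: algebra_simps)
  then show ?case using 3 by (simp add: algebra_simps)
qed auto

lemma surface_map_measurable:
  "(\<lambda>x::real^'n. x /\<^sub>R norm x)
     \<in> restrict_space lborel (ball 0 1 - {0}) \<rightarrow>\<^sub>M restrict_space borel (sphere 0 1)"
proof (rule measurable_restrict_space2)
  show "(\<lambda>x::real^'n. x /\<^sub>R norm x) \<in> space (restrict_space lborel (ball 0 1 - {0})) \<rightarrow> sphere 0 1"
    by (auto simp: space_restrict_space)
  show "(\<lambda>x::real^'n. x /\<^sub>R norm x) \<in> restrict_space lborel (ball 0 1 - {0}) \<rightarrow>\<^sub>M borel"
    by (rule measurable_restrict_space1) measurable
qed

lemma emeasure_surface_measure: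
  fixes A :: "(real^'n) set"
  assumes "A \<in> sets borel" "A \<subseteq> sphere 0 1"
  shows "emeasure surface_measure A =
    of_nat CARD('n) * emeasure lborel {t *\<^sub>R x | t x. 0 < t \<and> t < 1 \<and> x \<in> A}"
proof -
  let ?B = "ball (0::real^'n) 1 - {0}"
  have A: "A \<in> sets (restrict_space borel (sphere 0 1))"
    using assms by (subst sets_restrict_space_iff) auto
  have eq: "(\<lambda>x. x /\<^sub>R norm x) -` A \<inter> ?B = {t *\<^sub>R x | t x. 0 < t \<and> t < 1 \<and> x \<in> A}"
  proof (intro set_eqI iffI)
    fix z assume z: "z \<in> (\<lambda>x. x /\<^sub>R norm x) -` A \<inter> ?B"
    then have "z = norm z *\<^sub>R (z /\<^sub>R norm z)" "0 < norm z" "norm z < 1" "z /\<^sub>R norm z \<in> A"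
      by auto
    then show "z \<in> {t *\<^sub>R x | t x. 0 < t \<and> t < 1 \<and> x \<in> A}" by blast
  next
    fix z assume "z \<in> {t *\<^sub>R x | t x. 0 < t \<and> t < 1 \<and> x \<in> A}"
    then obtain t x where "z = t *\<^sub>R x" "0 < t" "t < 1" "x \<in> A" by blast
    moreover from this assms(2) have "norm x = 1" by auto
    ultimately show "z \<in> (\<lambda>x. x /\<^sub>R norm x) -` A \<inter> ?B" by auto
  qed
  have "emeasure (distr (restrict_space lborel ?B) (restrict_space borel (sphere 0 1))
          (\<lambda>x. x /\<^sub>R norm x)) A
      = emeasure (restrict_space lborel ?B) ((\<lambda>x. x /\<^sub>R norm x) -` A \<inter> ?B)"
    using emeasure_distr[OF surface_map_measurable A] by (simp add: space_restrict_space)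
  also have "\<dots> = emeasure lborel ((\<lambda>x. x /\<^sub>R norm x) -` A \<inter> ?B)"
    by (rule emeasure_restrict_space) auto
  finally show ?thesis
    by (simp add: surface_measure_def eq)
qed

lemma is_fourier_transform_fourier:
  "representable U \<Longrightarrow> is_fourier_transform U (fourier U)"
  unfolding representable_def fourier_def by (rule someI_ex[of "is_fourier_transform U"])

lemma integrable_mult_exp_ii:
  assumes "integrable lborel V"
  shows "integrable lborel (\<lambda>\<omega>::real^'n. V \<omega> * exp (\<i> * complex_of_real (\<omega> \<bullet> y)))"
proof (rule Bochner_Integration.integrable_bound[OF assms])
  show "(\<lambda>\<omega>. V \<omega> * exp (\<i> * complex_of_real (\<omega> \<bullet> y))) \<in> borel_measurable lborel"
    using borel_measurable_integrable[OF assms] by measurable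
qed (simp add: norm_mult)

lemma null_sets_kernel:
  fixes T :: "real^'m^'n"
  assumes "T \<noteq> 0"
  shows "{\<omega>. transpose T *v \<omega> = 0} \<in> null_sets lborel"
proof -
  have sub: "subspace {\<omega>. transpose T *v \<omega> = 0}"
    by (rule linear_subspace_kernel) (rule matrix_vector_mul_linear)
  have ne: "{\<omega>. transpose T *v \<omega> = 0} \<noteq> UNIV"
  proof
    assume "{\<omega>. transpose T *v \<omega> = 0} = UNIV"
    then have "\<forall>\<omega>. transpose T *v \<omega> = 0 *v \<omega>" by auto
    then have "transpose T = 0" by (subst matrix_eq)
    then have "T = 0" by (simp add: vec_eq_iff transpose_def)
    with assms show False by simp
  qed
  have "dim {\<omega>. transpose T *v \<omega> = 0} < DIM(real^'n)"
    using dim_eq_full[of "{\<omega>. transpose T *v \<omega> = 0}"] dim_subset_UNIV[of "{\<omega>. transpose T *v \<omega> = 0}"]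
      ne span_eq_iff sub by (metis le_neq_implies_less)
  then have "negligible {\<omega>. transpose T *v \<omega> = 0}" by (rule negligible_lowdim)
  moreover have "closed {\<omega>. transpose T *v \<omega> = 0}" by (rule closed_subspace[OF sub])
  ultimately show ?thesis
    by (auto simp: negligible_iff_null_sets null_sets_def)
qed

lemma solution_imp_equation:
  fixes T :: "real^'m^'n"
  assumes "T \<noteq> 0" "\<mu> \<ge> 0" "representable F" "representable U"
    and hat: "AE \<omega> in lborel.
      fourier U \<omega> = fourier F \<omega> / complex_of_real ((norm (transpose T *v \<omega>))\<^sup>2 + \<mu>)"
  shows "op_L T U y + complex_of_real (\<mu> * U y) = complex_of_real (F y)"
proof -
  let ?n = "\<lambda>\<omega>. (norm (transpose T *v \<omega>))\<^sup>2"
  let ?V = "\<lambda>\<omega>. complex_of_real (?n \<omega>) * fourier U \<omega>"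
  let ?e = "\<lambda>\<omega>. exp (\<i> * complex_of_real (\<omega> \<bullet> y))"
  let ?c = "complex_of_real ((2 * pi) powr (- real CARD('n) / 2))"
  note U = is_fourier_transform_fourier[OF assms(4), unfolded is_fourier_transform_def]
  note F = is_fourier_transform_fourier[OF assms(3), unfolded is_fourier_transform_def]
  have "AE \<omega> in lborel. transpose T *v \<omega> \<noteq> 0"
    using AE_not_in[OF null_sets_kernel[OF assms(1)]] by simp
  with hat have ae: "AE \<omega> in lborel. fourier F \<omega> - complex_of_real \<mu> * fourier U \<omega> = ?V \<omega>"
  proof eventually_elim
    case (elim \<omega>)
    have "?n \<omega> + \<mu> > 0" using elim(2) assms(2) by (simp add: add_pos_nonneg)
    then have "complex_of_real (?n \<omega> + \<mu>) \<noteq> 0" by (metis less_irrefl of_real_eq_0_iff)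
    with elim(1) have "fourier F \<omega> = complex_of_real (?n \<omega> + \<mu>) * fourier U \<omega>" by simp
    then show ?case by (simp add: algebra_simps)
  qed
  have [measurable]: "fourier U \<in> borel_measurable lborel" "fourier F \<in> borel_measurable lborel"
    using U F by (auto intro: borel_measurable_integrable)
  have [measurable]: "(\<lambda>\<omega>. transpose T *v \<omega>) \<in> borel_measurable borel"
    by (intro borel_measurable_continuous_onI linear_continuous_on
        linear_conv_bounded_linear[THEN iffD1] matrix_vector_mul_linear)
  have mV: "?V \<in> borel_measurable lborel" by measurable
  have "integrable lborel ?V \<longleftrightarrow>
      integrable lborel (\<lambda>\<omega>. fourier F \<omega> - complex_of_real \<mu> * fourier U \<omega>)"
    using ae mV U F by (intro integrable_cong_AE) (auto simp: eq_commute)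
  then have iV: "integrable lborel ?V" using U F by simp
  have "(LINT \<omega>|lborel. fourier F \<omega> * ?e \<omega>)
      = (LINT \<omega>|lborel. ?V \<omega> * ?e \<omega> + complex_of_real \<mu> * (fourier U \<omega> * ?e \<omega>))"
  proof (rule integral_cong_AE)
    show "AE \<omega> in lborel. fourier F \<omega> * ?e \<omega>
        = ?V \<omega> * ?e \<omega> + complex_of_real \<mu> * (fourier U \<omega> * ?e \<omega>)"
      using ae by eventually_elim (simp add: algebra_simps flip: distrib_right)
  qed measurable
  also have "\<dots> = (LINT \<omega>|lborel. ?V \<omega> * ?e \<omega>)
      + complex_of_real \<mu> * (LINT \<omega>|lborel. fourier U \<omega> * ?e \<omega>)"
    using integrable_mult_exp_ii[OF iV, of y] integrable_mult_exp_ii[of "fourier U" y] U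
    by (subst Bochner_Integration.integral_add) auto
  finally have "inverse_fourier (fourier F) y
      = inverse_fourier ?V y + complex_of_real \<mu> * inverse_fourier (fourier U) y"
    unfolding inverse_fourier_def by (simp add: algebra_simps)
  then show ?thesis using U F by (simp add: op_L_def)
qed

end

theory Submission
  imports Defs "HOL-Probability.Levy"
begin

text \<open>Since \<open>P\<^sub>k\<close> is bounded by \<open>1 / T\<^sub>k((b + a) / (b - a)) = 2 q\<^sup>k / (1 + q\<^sup>2\<^sup>k)\<close> on \<open>[a, b]\<close> and by
  \<open>1\<close> on \<open>[0, b]\<close>, the pointwise error is controlled by the first term on the set
  \<open>\<parallel>T\<^sup>t\<omega>\<parallel>\<^sup>2 > \<delta> \<parallel>\<omega>\<parallel>\<^sup>2\<close>, and by \<open>\<parallel>U - U\<^sub>\<delta>\<parallel>\<^sub>s\<close> outside it. The normalization of \<open>T\<close> enters only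
  through \<open>b \<ge> 1 > a\<close>.

  That the Fourier transform of a difference is the difference of the Fourier transforms rests on
  uniqueness: if all Fourier integrals of \<open>V\<close> vanish, then by the one-dimensional uniqueness theorem
  of Levy the same is true of \<open>V\<close> multiplied by the indicator of \<open>{x. x \<bullet> b \<in> A}\<close>. Doing this for
  one coordinate after the other shows that the integral of \<open>V\<close> over every box vanishes.\<close>

section \<open>Uniqueness for Fourier integrals of integrable functions\<close>

text \<open>The positive and negative parts of \<open>g\<close> have the same Fourier integrals, at
  \<open>t = 0\<close> in particular the same mass \<open>c\<close>. Divided by \<open>c > 0\<close>
  they are probability densities, under which \<open>X\<close> has laws with equal characteristic
  functions, hence equal laws by Levy's theorem.\<close>

lemma real_integral_level_sets_eq_0:
  fixes g X :: "'a \<Rightarrow> real"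
  assumes g: "integrable M g" and X [measurable]: "X \<in> borel_measurable M"
    and char0: "\<And>t. (\<integral>x. complex_of_real (g x) * iexp (t * X x) \<partial>M) = 0"
    and A [measurable]: "A \<in> sets borel"
  shows "(\<integral>x. g x * indicator A (X x) \<partial>M) = 0"
proof -
  have [measurable]: "g \<in> borel_measurable M"
    using g by (rule borel_measurable_integrable)
  define gp where "gp x = max (g x) 0" for x
  define gn where "gn x = max (- g x) 0" for x
  have g_eq: "g x = gp x - gn x" and nn: "gp x \<ge> 0" "gn x \<ge> 0" for x
    by (auto simp: gp_def gn_def)
  have [measurable]: "gp \<in> borel_measurable M" "gn \<in> borel_measurable M"
    by (auto simp: gp_def[abs_def] gn_def[abs_def])
  have ip: "integrable M gp" and iN: "integrable M gn"
    using g by (auto simp: gp_def[abs_def] gn_def[abs_def])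
  have char_eq: "(\<integral>x. complex_of_real (gp x) * iexp (t * X x) \<partial>M)
      = (\<integral>x. complex_of_real (gn x) * iexp (t * X x) \<partial>M)" for t
  proof -
    have "integrable M (\<lambda>x. complex_of_real (h x) * iexp (t * X x))"
      if "integrable M h" for h
    proof (rule Bochner_Integration.integrable_bound[OF that])
      show "(\<lambda>x. complex_of_real (h x) * iexp (t * X x)) \<in> borel_measurable M"
        using borel_measurable_integrable[OF that] by measurable
    qed (simp add: norm_mult)
    then have "(\<integral>x. complex_of_real (g x) * iexp (t * X x) \<partial>M)
        = (\<integral>x. complex_of_real (gp x) * iexp (t * X x) \<partial>M)
          - (\<integral>x. complex_of_real (gn x) * iexp (t * X x) \<partial>M)"
      using ip iN by (simp add: g_eq left_diff_distrib)
    then show ?thesis using char0 by simp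
  qed
  define c where "c = (\<integral>x. gp x \<partial>M)"
  have "complex_of_real c = complex_of_real (\<integral>x. gn x \<partial>M)"
    using char_eq[of 0] by (simp add: c_def flip: integral_complex_of_real)
  then have cn: "c = (\<integral>x. gn x \<partial>M)" by (simp only: of_real_eq_iff)
  show ?thesis
  proof (cases "c = 0")
    \<comment> \<open>Normalization is impossible here, but nonnegative functions with integral 0
      vanish almost everywhere.\<close>
    case True
    have "AE x in M. gp x = 0"
      using True integral_nonneg_eq_0_iff_AE[OF ip] nn by (simp add: c_def)
    moreover have "AE x in M. gn x = 0"
      using True integral_nonneg_eq_0_iff_AE[OF iN] nn by (simp add: cn)
    ultimately have "AE x in M. g x * indicator A (X x) = 0"
      by eventually_elim (simp add: g_eq)
    then show ?thesis by (subst integral_cong_AE[where g="\<lambda>_. 0"]) auto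
  next
    case False
    then have c: "c > 0"
      using nn by (simp add: c_def integral_nonneg order_less_le)
    \<comment> \<open>The law of \<open>X\<close> under the density \<open>h / c\<close>, to be used
      for \<open>h = gp\<close> and \<open>h = gn\<close>.\<close>
    define D where "D h = distr (density M (\<lambda>x. ennreal (h x / c))) borel X" for h
    have real_distr: "real_distribution (D h)"
      and char_D: "char (D h) t = (\<integral>x. complex_of_real (h x) * iexp (t * X x) \<partial>M) / c"
      and measure_D: "measure (D h) A = (\<integral>x. h x * indicator A (X x) \<partial>M) / c"
      if h: "integrable M h" "\<And>x. h x \<ge> 0" "(\<integral>x. h x \<partial>M) = c" for h t
    proof -
      have [measurable]: "h \<in> borel_measurable M"
        using h(1) by (rule borel_measurable_integrable)
      have "prob_space (density M (\<lambda>x. ennreal (h x / c)))"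
      proof
        have "emeasure (density M (\<lambda>x. ennreal (h x / c))) (space M)
            = (\<integral>\<^sup>+x. ennreal (h x / c) \<partial>M)"
          by (subst emeasure_density) (auto intro!: nn_integral_cong)
        also have "\<dots> = ennreal (\<integral>x. h x / c \<partial>M)"
          using h c by (intro nn_integral_eq_integral) auto
        also have "\<dots> = 1" using h c by simp
        finally show "emeasure (density M (\<lambda>x. ennreal (h x / c)))
            (space (density M (\<lambda>x. ennreal (h x / c)))) = 1" by simp
      qed
      then show "real_distribution (D h)"
        unfolding D_def by (rule prob_space.real_distribution_distr) simp
      have "char (D h) t = (\<integral>x. iexp (t * X x) \<partial>density M (\<lambda>x. ennreal (h x / c)))"
        unfolding char_def D_def by (subst integral_distr) auto
      also have "\<dots> = (\<integral>x. (h x / c) *\<^sub>R iexp (t * X x) \<partial>M)"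
        using h c by (subst integral_density) auto
      also have "\<dots> = (\<integral>x. complex_of_real (h x) * iexp (t * X x) / c \<partial>M)"
        by (intro Bochner_Integration.integral_cong) (auto simp: scaleR_conv_of_real)
      finally show "char (D h) t = (\<integral>x. complex_of_real (h x) * iexp (t * X x) \<partial>M) / c"
        by simp
      have "measure (D h) A = (\<integral>x. indicator A x \<partial>D h)"
        by (simp add: D_def)
      also have "\<dots> = (\<integral>x. indicator A (X x) \<partial>density M (\<lambda>x. ennreal (h x / c)))"
        unfolding D_def by (subst integral_distr) auto
      also have "\<dots> = (\<integral>x. (h x / c) *\<^sub>R indicator A (X x) \<partial>M)"
        using h c by (subst integral_density) auto
      finally show "measure (D h) A = (\<integral>x. h x * indicator A (X x) \<partial>M) / c"
        by simp
    qed
    have "char (D gp) = char (D gn)"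
      using char_D[of gp] char_D[of gn] char_eq ip iN nn cn by (auto simp: c_def)
    then have "D gp = D gn"
      using real_distr[of gp] real_distr[of gn] ip iN nn cn
      by (intro Levy_uniqueness) (auto simp: c_def)
    then have "(\<integral>x. gp x * indicator A (X x) \<partial>M) = (\<integral>x. gn x * indicator A (X x) \<partial>M)"
      using measure_D[of gp] measure_D[of gn] ip iN nn cn c by (auto simp: c_def)
    moreover have "(\<integral>x. g x * indicator A (X x) \<partial>M)
        = (\<integral>x. gp x * indicator A (X x) \<partial>M) - (\<integral>x. gn x * indicator A (X x) \<partial>M)"
    proof -
      have "integrable M (\<lambda>x. h x * indicator A (X x))" if "integrable M h" for h :: "'a \<Rightarrow> real"
      proof (rule Bochner_Integration.integrable_bound[OF that])
        show "(\<lambda>x. h x * indicator A (X x)) \<in> borel_measurable M"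
          using borel_measurable_integrable[OF that] by measurable
      qed (simp add: indicator_def)
      then show ?thesis using ip iN by (simp add: g_eq left_diff_distrib)
    qed
    ultimately show ?thesis by simp
  qed
qed

lemma integrable_mult_iexp:
  assumes "integrable M V" "X \<in> borel_measurable M"
  shows "integrable M (\<lambda>x. V x * iexp (X x))"
proof (rule Bochner_Integration.integrable_bound[OF assms(1)])
  show "(\<lambda>x. V x * iexp (X x)) \<in> borel_measurable M"
    using borel_measurable_integrable[OF assms(1)] assms(2) by measurable
qed (simp add: norm_mult)

lemma integrable_mult_indicator_vimage:
  fixes V :: "'a \<Rightarrow> complex"
  assumes "integrable M V" "X \<in> borel_measurable M" "A \<in> sets borel"
  shows "integrable M (\<lambda>x. V x * indicator A (X x :: real))"
proof (rule Bochner_Integration.integrable_bound[OF assms(1)])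
  show "(\<lambda>x. V x * indicator A (X x)) \<in> borel_measurable M"
    using borel_measurable_integrable[OF assms(1)] assms(2,3) by measurable
qed (simp add: indicator_def)

text \<open>The real case is applied to \<open>Re V\<close> and to
  \<open>Im V = Re (- \<i> * V)\<close>.\<close>

lemma integral_level_sets_eq_0:
  fixes V :: "'a \<Rightarrow> complex" and X :: "'a \<Rightarrow> real"
  assumes V: "integrable M V" and X: "X \<in> borel_measurable M"
    and char0: "\<And>t. (\<integral>x. V x * iexp (t * X x) \<partial>M) = 0"
    and A: "A \<in> sets borel"
  shows "(\<integral>x. V x * indicator A (X x) \<partial>M) = 0"
proof -
  have Re0: "(\<integral>x. Re (W x) * indicator A (X x) \<partial>M) = 0"
    if W: "integrable M W" "\<And>t. (\<integral>x. W x * iexp (t * X x) \<partial>M) = 0" for W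
  proof (rule real_integral_level_sets_eq_0[OF _ X _ A])
    show "integrable M (\<lambda>x. Re (W x))" using W(1) by simp
    fix t
    have meas: "(\<lambda>x. t * X x) \<in> borel_measurable M" "(\<lambda>x. - t * X x) \<in> borel_measurable M"
      using X by auto
    \<comment> \<open>The conjugate of \<open>iexp (- t * X x)\<close> is
      \<open>iexp (t * X x)\<close>, so the hypothesis at \<open>t\<close> and the conjugated
      hypothesis at \<open>- t\<close> combine to a statement about the real part.\<close>
    have "(\<integral>x. complex_of_real (Re (W x)) * iexp (t * X x) \<partial>M)
        = (\<integral>x. (W x * iexp (t * X x) + cnj (W x * iexp (- t * X x))) / 2 \<partial>M)"
    proof (intro Bochner_Integration.integral_cong refl)
      fix x
      have Re: "complex_of_real (Re (W x)) = (W x + cnj (W x)) / 2"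
        by (simp add: complex_add_cnj)
      show "complex_of_real (Re (W x)) * iexp (t * X x)
          = (W x * iexp (t * X x) + cnj (W x * iexp (- t * X x))) / 2"
        unfolding Re by (simp add: exp_cnj distrib_right)
    qed
    also have "\<dots> = ((\<integral>x. W x * iexp (t * X x) \<partial>M)
        + cnj (\<integral>x. W x * iexp (- t * X x) \<partial>M)) / 2"
      using integrable_mult_iexp[OF W(1) meas(1)] integrable_mult_iexp[OF W(1) meas(2)]
      by (simp del: complex_cnj_mult)
    finally show "(\<integral>x. complex_of_real (Re (W x)) * iexp (t * X x) \<partial>M) = 0"
      using W(2)[of t] W(2)[of "- t"] by simp
  qed
  note i = integrable_mult_indicator_vimage[OF V X A]
  have ind: "indicator A y = complex_of_real (indicator A y)" for y :: real
    by (simp add: indicator_def)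
  have iV: "(\<integral>x. (- \<i> * V x) * iexp (t * X x) \<partial>M) = 0" for t
  proof -
    have "(\<integral>x. (- \<i> * V x) * iexp (t * X x) \<partial>M) = - \<i> * (\<integral>x. V x * iexp (t * X x) \<partial>M)"
      by (subst integral_mult_right_zero[symmetric]) (simp add: mult.assoc)
    then show ?thesis using char0 by simp
  qed
  have "Re (\<integral>x. V x * indicator A (X x) \<partial>M) = (\<integral>x. Re (V x * indicator A (X x)) \<partial>M)"
    by (rule integral_Re[OF i, symmetric])
  also have "\<dots> = 0"
    using Re0[OF V char0] by (simp add: ind)
  finally have 1: "Re (\<integral>x. V x * indicator A (X x) \<partial>M) = 0" .
  have "Im (\<integral>x. V x * indicator A (X x) \<partial>M) = (\<integral>x. Im (V x * indicator A (X x)) \<partial>M)"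
    by (rule integral_Im[OF i, symmetric])
  also have "\<dots> = 0"
    using Re0[OF _ iV] V by (simp add: ind)
  finally have 2: "Im (\<integral>x. V x * indicator A (X x) \<partial>M) = 0" .
  from 1 2 show ?thesis by (simp add: complex_eq_iff)
qed

text \<open>The indicator of a box is a product of indicators in the single coordinates. These
  factors are multiplied in one at a time, by induction over finite sets \<open>B\<close> of
  directions.\<close>

lemma integral_box_eq_0:
  fixes V :: "'a::euclidean_space \<Rightarrow> complex"
  assumes V: "integrable lborel V"
    and char0: "\<And>y. (\<integral>x. V x * iexp (x \<bullet> y) \<partial>lborel) = 0"
  shows "(\<integral>x. V x * indicator (box l u) x \<partial>lborel) = 0"
proof -
  define W where "W B x = V x * (\<Prod>b\<in>B. indicator {l \<bullet> b<..<u \<bullet> b} (x \<bullet> b))" for B and x :: 'a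
  \<comment> \<open>The claim keeps all frequencies \<open>y\<close>, because the induction step
    draws on the shifted frequencies \<open>y + t *\<^sub>R b\<close>.\<close>
  have "integrable lborel (W B) \<and> (\<forall>y. (\<integral>x. W B x * iexp (x \<bullet> y) \<partial>lborel) = 0)"
    if "finite B" for B
    using that
  proof induction
    case empty
    then show ?case using V char0 by (simp add: W_def[abs_def])
  next
    case (insert b B)
    have W_insert: "W (insert b B) x = W B x * indicator {l \<bullet> b<..<u \<bullet> b} (x \<bullet> b)" for x
      using insert.hyps by (simp add: W_def mult_ac)
    have "(\<integral>x. W B x * indicator {l \<bullet> b<..<u \<bullet> b} (x \<bullet> b) * iexp (x \<bullet> y) \<partial>lborel) = 0" for y
    proof -
      \<comment> \<open>The factor \<open>iexp (x \<bullet> y)\<close> is counted as part of the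
        function, whose one-dimensional transforms in direction \<open>b\<close> are then Fourier
        integrals of \<open>W B\<close>.\<close>
      have "(\<integral>x. W B x * iexp (x \<bullet> y) * indicator {l \<bullet> b<..<u \<bullet> b} (x \<bullet> b) \<partial>lborel) = 0"
      proof (rule integral_level_sets_eq_0)
        show "integrable lborel (\<lambda>x. W B x * iexp (x \<bullet> y))"
          using insert.IH by (intro integrable_mult_iexp) auto
        fix t
        have "W B x * iexp (x \<bullet> y) * iexp (t * (x \<bullet> b)) = W B x * iexp (x \<bullet> (y + t *\<^sub>R b))" for x
          by (simp add: inner_add_right distrib_left exp_add)
        then show "(\<integral>x. W B x * iexp (x \<bullet> y) * iexp (t * (x \<bullet> b)) \<partial>lborel) = 0"
          using insert.IH by (simp only:)
      qed auto
      then show ?thesis by (simp add: mult_ac)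
    qed
    moreover have "integrable lborel (\<lambda>x. W B x * indicator {l \<bullet> b<..<u \<bullet> b} (x \<bullet> b))"
      using insert.IH by (intro integrable_mult_indicator_vimage) auto
    ultimately show ?case by (simp add: W_insert)
  qed
  from this[OF finite_Basis] have "(\<integral>x. W Basis x \<partial>lborel) = 0"
    by (metis (no_types, lifting) inner_zero_right mult_zero_right of_real_0 exp_zero mult.right_neutral
        Bochner_Integration.integral_cong)
  moreover have "(\<Prod>b\<in>Basis. indicator {l \<bullet> b<..<u \<bullet> b} (x \<bullet> b)) = (indicator (box l u) x :: complex)" for x
  proof (cases "x \<in> box l u")
    case True
    then show ?thesis by (simp add: mem_box)
  next
    case False
    then obtain b where "b \<in> Basis" "x \<bullet> b \<notin> {l \<bullet> b<..<u \<bullet> b}" by (auto simp: mem_box)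
    then have "(\<Prod>b\<in>Basis. indicator {l \<bullet> b<..<u \<bullet> b} (x \<bullet> b)) = (0::complex)"
      by (intro prod_zero) (auto intro!: bexI[of _ b])
    with False show ?thesis by simp
  qed
  ultimately show ?thesis by (simp add: W_def)
qed

text \<open>It suffices that the integrals of \<open>V\<close> over all Borel sets vanish. The boxes
  form an intersection-stable generator, so the result for boxes extends by Dynkin's
  argument.\<close>

lemma AE_eq_0_if_fourier_eq_0:
  fixes V :: "'a::euclidean_space \<Rightarrow> complex"
  assumes V: "integrable lborel V"
    and char0: "\<And>y. (\<integral>x. V x * iexp (x \<bullet> y) \<partial>lborel) = 0"
  shows "AE x in lborel. V x = 0"
proof (rule sigma_finite_measure.density_zero[OF lborel.sigma_finite_measure_axioms])
  have int: "set_integrable lborel A V" if "A \<in> sets borel" for A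
    using V that by (simp add: set_integrable_def integrable_mult_indicator)
  \<comment> \<open>The total integral, needed for complements, is the Fourier integral at frequency
    0.\<close>
  have UNIV: "set_lebesgue_integral lborel UNIV V = 0"
    using char0[of 0] by (simp add: set_lebesgue_integral_def)
  fix A :: "'a set" assume "A \<in> sets lborel"
  then have A: "A \<in> sigma_sets UNIV (range (\<lambda>(a, b). box a b :: 'a set))"
    by (simp add: borel_eq_box)
  have int_stable: "Int_stable (range (\<lambda>(a, b). box a b :: 'a set))"
    by (auto simp: Int_stable_def box_Int_box)
  have "range (\<lambda>(a, b). box a b :: 'a set) \<subseteq> Pow UNIV" by simp
  from int_stable this A show "set_lebesgue_integral lborel A V = 0"
  proof (induction rule: sigma_sets_induct_disjoint)
    case (basic A)
    then obtain l u where "A = box l u" by auto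
    then show ?case
      using integral_box_eq_0[OF assms, of l u]
      by (simp add: set_lebesgue_integral_def scaleR_conv_of_real mult.commute of_real_indicator)
  next
    case (compl A)
    then have [simp]: "A \<in> sets borel" by (simp add: borel_eq_box)
    have "set_lebesgue_integral lborel (A \<union> (UNIV - A)) V
        = set_lebesgue_integral lborel A V + set_lebesgue_integral lborel (UNIV - A) V"
      by (rule set_integral_Un) (auto intro!: int)
    then show ?case using compl UNIV by simp
  next
    case (union A)
    then have [simp]: "A i \<in> sets borel" for i by (auto simp: borel_eq_box)
    have "set_lebesgue_integral lborel (\<Union>i. A i) V = (\<Sum>i. set_lebesgue_integral lborel (A i) V)"
      using union.hyps by (intro lebesgue_integral_countable_add) (auto intro!: int simp: disjoint_family_on_def)
    then show ?case using union by simp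
  qed (simp add: set_lebesgue_integral_def)
qed (use V in auto)

section \<open>Fourier transforms of differences\<close>

lemma is_fourier_transform_diff:
  assumes "is_fourier_transform U V" "is_fourier_transform U' V'"
  shows "is_fourier_transform (\<lambda>y. U y - U' y) (\<lambda>\<omega>. V \<omega> - V' \<omega>)"
  using assms integrable_mult_exp_ii[of V] integrable_mult_exp_ii[of V']
  by (auto simp: is_fourier_transform_def inverse_fourier_def left_diff_distrib right_diff_distrib)

lemma representable_diff:
  "representable U \<Longrightarrow> representable U' \<Longrightarrow> representable (\<lambda>y. U y - U' y)"
  unfolding representable_def by (blast intro: is_fourier_transform_diff)

lemma borel_measurable_fourier:
  assumes "representable U"
  shows "fourier U \<in> borel_measurable borel"
proof -
  have "integrable lborel (fourier U)"
    using is_fourier_transform_fourier[OF assms] by (simp add: is_fourier_transform_def)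
  from borel_measurable_integrable[OF this] show ?thesis by simp
qed

text \<open>The difference of the two functions represents 0, and the prefactor in
  \<open>inverse_fourier\<close> is nonzero.\<close>

lemma is_fourier_transform_unique:
  assumes "is_fourier_transform U V" "is_fourier_transform U V'"
  shows "AE \<omega> in lborel. V \<omega> = V' \<omega>"
proof -
  note diff = is_fourier_transform_diff[OF assms]
  have "AE \<omega> in lborel. V \<omega> - V' \<omega> = 0"
    using diff by (intro AE_eq_0_if_fourier_eq_0)
      (auto simp: is_fourier_transform_def inverse_fourier_def)
  then show ?thesis by simp
qed

text \<open>\<open>fourier\<close> picks a representing function for each argument separately, so
  the identity comes from uniqueness and holds almost everywhere.\<close>

lemma fourier_diff:
  assumes "representable U" "representable U'"
  shows "AE \<omega> in lborel. fourier (\<lambda>y. U y - U' y) \<omega> = fourier U \<omega> - fourier U' \<omega>"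
  by (rule is_fourier_transform_unique[OF is_fourier_transform_fourier[OF representable_diff]
        is_fourier_transform_diff]) (use assms in \<open>simp_all add: is_fourier_transform_fourier\<close>)

section \<open>Bounds for Chebyshev polynomials\<close>

text \<open>The hyperbolic counterpart of \<open>chebyshev_cos\<close>, from the same recurrence; it
  covers the arguments from 1 upwards.\<close>

lemma chebyshev_cosh: "poly (chebyshev k) (cosh t) = cosh (real k * t)"
proof (induction k rule: chebyshev.induct)
  case (3 k)
  have "cosh (real (Suc (Suc k)) * t) + cosh (real k * t) = 2 * cosh t * cosh (real (Suc k) * t)"
    using cosh_add[of "real (Suc k) * t" t] cosh_diff[of "real (Suc k) * t" t]
    by (simp add: algebra_simps)
  then show ?case using 3 by (simp add: algebra_simps)
qed auto

lemma arcosh_real_mono: "1 \<le> x \<Longrightarrow> x \<le> y \<Longrightarrow> arcosh x \<le> arcosh (y::real)"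
  using arcosh_less_iff_real[of y x] by linarith

text \<open>From 1 upwards the polynomial is \<open>cosh (real k * arcosh x)\<close>, a composition
  of monotone functions.\<close>

lemma chebyshev_mono:
  assumes "1 \<le> x" "x \<le> y"
  shows "poly (chebyshev k) x \<le> poly (chebyshev k) y"
proof -
  have "cosh (real k * arcosh x) \<le> cosh (real k * arcosh y)"
    using assms by (subst cosh_real_nonneg_le_iff)
      (auto intro!: mult_left_mono mult_nonneg_nonneg simp: arcosh_real_mono)
  then show ?thesis
    using assms chebyshev_cosh[of k "arcosh x"] chebyshev_cosh[of k "arcosh y"] by simp
qed

lemma chebyshev_ge_1: "1 \<le> x \<Longrightarrow> 1 \<le> poly (chebyshev k) x"
  using chebyshev_cosh[of k "arcosh x"] by (simp add: cosh_real_ge_1)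

lemma abs_chebyshev_le_1: "\<bar>x\<bar> \<le> 1 \<Longrightarrow> \<bar>poly (chebyshev k) x\<bar> \<le> 1"
  using chebyshev_cos[of k "arccos x"] by (simp add: cos_arccos_abs)

text \<open>With \<open>x = exp t\<close> the argument is \<open>cosh t\<close> and the value is
  \<open>cosh (real k * t)\<close>.\<close>

lemma chebyshev_add_inverse:
  assumes "x > 0"
  shows "poly (chebyshev k) ((x + inverse x) / 2) = (x ^ k + inverse (x ^ k)) / 2"
  using chebyshev_cosh[of k "ln x"] assms by (simp add: cosh_ln_real flip: ln_realpow)

text \<open>The transformed argument is at least 1 and at most its value at \<open>l = 0\<close>,
  which is the argument in the denominator. By monotonicity the quotient lies between 0 and
  1.\<close>

lemma abs_chebyshev_on_le_1:
  assumes "0 \<le> l" "l \<le> a" "a < b"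
  shows "\<bar>chebyshev_on a b k l\<bar> \<le> 1"
proof -
  let ?x = "(b + a - 2 * l) / (b - a)" and ?y = "(b + a) / (b - a)"
  have "1 \<le> ?x" using assms by (simp add: le_divide_eq)
  moreover have "?x \<le> ?y" using assms by (intro divide_right_mono) auto
  ultimately have "1 \<le> poly (chebyshev k) ?x" "poly (chebyshev k) ?x \<le> poly (chebyshev k) ?y"
    by (auto intro: chebyshev_ge_1 chebyshev_mono)
  then show ?thesis by (simp add: chebyshev_on_def)
qed

text \<open>The transformed argument lies in \<open>[-1, 1]\<close>, so the numerator is at most 1
  in modulus. The denominator is explicit because
  \<open>(b + a) / (b - a) = (q + inverse q) / 2\<close>.\<close>

lemma abs_chebyshev_on_le:
  assumes "a \<le> l" "l \<le> b" "0 < a" "a < b"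
    and q: "q = (sqrt (b / a) - 1) / (sqrt (b / a) + 1)"
  shows "\<bar>chebyshev_on a b k l\<bar> \<le> 2 * q ^ k / (1 + q ^ (2 * k))"
proof -
  \<comment> \<open>With \<open>b = r\<^sup>2 * a\<close> all quantities become rational in
    \<open>r\<close>.\<close>
  define r where "r = sqrt (b / a)"
  have r: "r > 1" "b = r\<^sup>2 * a" using assms by (auto simp: r_def)
  have q: "q = (r - 1) / (r + 1)" using q by (simp add: r_def)
  have q0: "q > 0" using r by (simp add: q)
  have r2: "r\<^sup>2 > 1" using r(1) by (simp add: one_less_power)
  then have r2': "r * r \<noteq> 1" by (simp add: power2_eq_square)
  have "(q + inverse q) / 2 = (r\<^sup>2 + 1) / (r\<^sup>2 - 1)"
    using r(1) r2' by (simp add: q divide_simps power2_eq_square) (simp add: algebra_simps)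
  also have "\<dots> = (b + a) / (b - a)"
  proof -
    have "b + a = (r\<^sup>2 + 1) * a" "b - a = (r\<^sup>2 - 1) * a" by (simp_all add: r(2) algebra_simps)
    with assms(3) show ?thesis by simp
  qed
  finally have y: "(b + a) / (b - a) = (q + inverse q) / 2" ..
  let ?x = "(b + a - 2 * l) / (b - a)"
  have "\<bar>?x\<bar> \<le> 1" using assms by (auto simp: abs_le_iff field_simps)
  then have "\<bar>poly (chebyshev k) ?x\<bar> \<le> 1" by (rule abs_chebyshev_le_1)
  moreover have "q ^ k > 0" using q0 by simp
  ultimately have "\<bar>chebyshev_on a b k l\<bar> \<le> 1 / ((q ^ k + inverse (q ^ k)) / 2)"
    unfolding chebyshev_on_def y chebyshev_add_inverse[OF q0] abs_divide
    by (intro frac_le) (auto intro!: divide_pos_pos add_pos_pos)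
  also have "\<dots> = 2 * q ^ k / (1 + q ^ (2 * k))"
  proof -
    have "q ^ (2 * k) = (q ^ k)\<^sup>2" by (simp add: power_mult mult.commute[of 2])
    with \<open>q ^ k > 0\<close> show ?thesis
      by (simp add: divide_simps power2_eq_square add_pos_pos)
  qed
  finally show ?thesis .
qed

section \<open>Mean values over the unit sphere\<close>

lemma space_surface_measure: "space (surface_measure :: (real^'n) measure) = sphere 0 1"
  by (simp add: surface_measure_def space_scale_measure space_restrict_space)

text \<open>The cone over the whole sphere is the unit ball without its centre, and the centre is a
  null set.\<close>

lemma emeasure_surface_measure_sphere:
  "emeasure surface_measure (sphere 0 1 :: (real^'n) set)
    = ennreal (real CARD('n) * measure lborel (ball (0::real^'n) 1))"
proof -
  have cone: "{t *\<^sub>R x | t x. 0 < t \<and> t < 1 \<and> x \<in> sphere (0::real^'n) 1} = ball 0 1 - {0}"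
  proof (intro set_eqI iffI)
    fix z :: "real^'n" assume "z \<in> ball 0 1 - {0}"
    then have "z = norm z *\<^sub>R (z /\<^sub>R norm z)" "0 < norm z" "norm z < 1" "z /\<^sub>R norm z \<in> sphere 0 1"
      by auto
    then show "z \<in> {t *\<^sub>R x | t x. 0 < t \<and> t < 1 \<and> x \<in> sphere 0 1}" by blast
  qed auto
  have "emeasure surface_measure (sphere 0 1 :: (real^'n) set)
      = of_nat CARD('n) * emeasure lborel (ball (0::real^'n) 1 - {0})"
    using emeasure_surface_measure[of "sphere 0 1 :: (real^'n) set"] unfolding cone by simp
  also have "emeasure lborel (ball (0::real^'n) 1 - {0}) = emeasure lborel (ball (0::real^'n) 1)"
    by (intro emeasure_Diff_null_set) (auto simp: null_sets_def)
  also have "\<dots> = ennreal (measure lborel (ball (0::real^'n) 1))"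
    using emeasure_lborel_ball_finite[of "0::real^'n" 1]
    by (intro emeasure_eq_ennreal_measure) (simp add: less_top)
  finally show ?thesis
    by (simp add: ennreal_mult ennreal_of_nat_eq_real_of_nat)
qed

text \<open>The prefactor is the reciprocal of the total surface measure, so the left-hand side is a
  mean value.\<close>

lemma surface_mean_le:
  fixes f :: "real^'n \<Rightarrow> real"
  assumes "\<And>\<eta>. norm \<eta> = 1 \<Longrightarrow> f \<eta> \<le> c" "c \<ge> 0"
  shows "1 / (real CARD('n) * measure lborel (ball (0 :: real^'n) 1)) * (LINT \<eta>|surface_measure. f \<eta>) \<le> c"
proof -
  let ?s = "real CARD('n) * measure lborel (ball (0 :: real^'n) 1)"
  have space: "emeasure surface_measure (space (surface_measure :: (real^'n) measure)) = ennreal ?s"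
    by (simp add: space_surface_measure emeasure_surface_measure_sphere)
  interpret finite_measure "surface_measure :: (real^'n) measure"
    by (rule finite_measureI) (simp only: space ennreal_neq_top infinity_ennreal_def not_False_eq_True)
  have s: "?s > 0" using content_ball_pos[of 1 "0::real^'n"] by simp
  have "(LINT \<eta>|surface_measure. f \<eta>) \<le> ?s * c"
  \<comment> \<open>The integral of a non-integrable function is 0 by convention; there
    \<open>c \<ge> 0\<close> gives the bound.\<close>
  proof (cases "integrable surface_measure f")
    case True
    then have "(LINT \<eta>|surface_measure. f \<eta>) \<le> (LINT \<eta>|(surface_measure :: (real^'n) measure). c)"
      using assms by (intro integral_mono) (auto simp: space_surface_measure)
    also have "\<dots> = ?s * c"
      using s space by (simp add: measure_def)
    finally show ?thesis .
  qed (use s assms in \<open>simp add: not_integrable_integral_eq\<close>)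
  with s show ?thesis by (simp add: field_simps)
qed

section \<open>Pointwise estimate of the error and integration\<close>

theorem theorem4p2:
  fixes T :: "real^'m^'n"
    and \<mu> s \<delta> a b \<kappa> q :: real
    and F U U\<^sub>k U\<^sub>\<delta> :: "real^'n \<Rightarrow> real"
    and k :: nat
  assumes dims: "CARD('m) < CARD('n)"
    and full_rank: "rank T = CARD('m)"
    and normalized:
      "1 / (real CARD('n) * measure lborel (ball (0 :: real^'n) 1)) *
         (LINT \<eta>|surface_measure. (norm (transpose T *v \<eta>))\<^sup>2) = 1"
    and mu: "\<mu> \<ge> 0"
    and F: "representable F"
    and F0: "\<mu> = 0 \<longrightarrow>
      integrable lborel (\<lambda>\<omega>. fourier F \<omega> / complex_of_real ((norm (transpose T *v \<omega>))\<^sup>2))"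
    and U: "is_solution T \<mu> F U"
    and delta: "0 < \<delta>" "\<delta> < 1"
    and a: "a = \<delta>"
    and b: "b = (onorm (\<lambda>\<omega>. transpose T *v \<omega>))\<^sup>2"
    and kappa: "\<kappa> = b / a"
    and q: "q = (sqrt \<kappa> - 1) / (sqrt \<kappa> + 1)"
    and Uk: "representable U\<^sub>k"
      "AE \<omega> in lborel. fourier U \<omega> - fourier U\<^sub>k \<omega> =
         complex_of_real
           (chebyshev_on a b k
              (1 / ((norm \<omega>)\<^sup>2 + \<mu>) * ((norm (transpose T *v \<omega>))\<^sup>2 + \<mu>))) *
         fourier U \<omega>"
    and Udelta: "representable U\<^sub>\<delta>"
      "AE \<omega> in lborel. fourier U\<^sub>\<delta> \<omega> =
         (if (norm (transpose T *v \<omega>))\<^sup>2 > \<delta> * (norm \<omega>)\<^sup>2 then fourier U \<omega> else 0)"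
  shows "snorm T s (\<lambda>y. U y - U\<^sub>k y)
    \<le> ennreal (2 * q ^ k / (1 + q ^ (2 * k))) * snorm T s U
      + snorm T s (\<lambda>y. U y - U\<^sub>\<delta> y)"
proof -
  define N where "N \<omega> = norm (transpose T *v \<omega>)" for \<omega>
  define c where "c = 2 * q ^ k / (1 + q ^ (2 * k))"
  have N_le: "(N \<omega>)\<^sup>2 \<le> b * (norm \<omega>)\<^sup>2" for \<omega>
  proof -
    have "N \<omega> \<le> onorm (\<lambda>\<omega>. transpose T *v \<omega>) * norm \<omega>"
      unfolding N_def by (intro onorm linear_conv_bounded_linear[THEN iffD1] matrix_vector_mul_linear)
    then have "(N \<omega>)\<^sup>2 \<le> (onorm (\<lambda>\<omega>. transpose T *v \<omega>) * norm \<omega>)\<^sup>2"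
      by (intro power_mono) (auto simp: N_def)
    then show ?thesis by (simp add: b power_mult_distrib)
  qed
  have "(N \<eta>)\<^sup>2 \<le> b" if "norm \<eta> = 1" for \<eta>
    using N_le[of \<eta>] that by simp
  moreover have "b \<ge> 0" by (simp add: b)
  \<comment> \<open>By the normalization 1 is the mean value of \<open>(N \<eta>)\<^sup>2\<close>
    over the sphere, where \<open>b\<close> is an upper bound.\<close>
  ultimately have "b \<ge> 1"
    using surface_mean_le[of "\<lambda>\<eta>. (N \<eta>)\<^sup>2" b] unfolding normalized[folded N_def] by blast
  then have ab: "0 < a" "a < b" using a delta by auto
  \<comment> \<open>\<open>c\<close> bounds a modulus, for instance that of the value at
    \<open>l = a\<close>.\<close>
  have "c \<ge> 0"
    using abs_chebyshev_on_le[of a a b q k] ab q kappa by (simp add: c_def)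
  have P_le: "\<bar>chebyshev_on a b k (1 / ((norm \<omega>)\<^sup>2 + \<mu>) * ((N \<omega>)\<^sup>2 + \<mu>))\<bar>
      \<le> (if (N \<omega>)\<^sup>2 > \<delta> * (norm \<omega>)\<^sup>2 then c else 1)" if "\<omega> \<noteq> 0" for \<omega>
  proof -
    define l where "l = 1 / ((norm \<omega>)\<^sup>2 + \<mu>) * ((N \<omega>)\<^sup>2 + \<mu>)"
    \<comment> \<open>For \<open>\<mu> = 0\<close> positivity comes from
      \<open>\<omega> \<noteq> 0\<close>.\<close>
    have pos: "(norm \<omega>)\<^sup>2 + \<mu> > 0" using that mu by (simp add: add_pos_nonneg)
    have l: "0 \<le> l" using pos mu by (simp add: l_def)
    have l_eq: "l = ((N \<omega>)\<^sup>2 + \<mu>) / ((norm \<omega>)\<^sup>2 + \<mu>)" by (simp add: l_def)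
    \<comment> \<open>Adding \<open>\<mu>\<close> to numerator and denominator moves the quotient
      towards 1, so the upper bound \<open>b \<ge> 1\<close> survives.\<close>
    have "1 * \<mu> \<le> b * \<mu>" using \<open>b \<ge> 1\<close> mu by (rule mult_right_mono)
    then have "(N \<omega>)\<^sup>2 + \<mu> \<le> b * ((norm \<omega>)\<^sup>2 + \<mu>)"
      using N_le[of \<omega>] unfolding distrib_left by linarith
    then have l_b: "l \<le> b" by (simp only: l_eq pos_divide_le_eq[OF pos])
    show ?thesis
    proof (cases "(N \<omega>)\<^sup>2 > \<delta> * (norm \<omega>)\<^sup>2")
      case True
      \<comment> \<open>Likewise the lower bound \<open>a = \<delta> < 1\<close> survives.\<close>
      have "\<delta> * \<mu> \<le> \<mu>" using delta mu by (simp add: mult_left_le_one_le)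
      with True have "a * ((norm \<omega>)\<^sup>2 + \<mu>) \<le> (N \<omega>)\<^sup>2 + \<mu>"
        unfolding a distrib_left by linarith
      then have "a \<le> l" by (simp only: l_eq pos_le_divide_eq[OF pos])
      with True show ?thesis
        using abs_chebyshev_on_le[of a l b q k] l_b ab q kappa by (simp add: c_def l_def)
    next
      case False
      have "c \<le> 1"
      proof -
        have "0 \<le> (1 - q ^ k)\<^sup>2" by simp
        then have "2 * q ^ k \<le> 1 + q ^ (2 * k)"
          by (simp add: power2_diff power_mult[symmetric] mult.commute)
        moreover have "1 + q ^ (2 * k) > 0" by (simp add: power_mult add_pos_nonneg)
        ultimately show ?thesis by (simp add: c_def)
      qed
      \<comment> \<open>Here \<open>l\<close> may lie on either side of \<open>a\<close>, since a
        positive \<open>\<mu>\<close> can lift it above \<open>a\<close>. Beyond \<open>a\<close>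
        the bound \<open>c\<close> applies, and \<open>c \<le> 1\<close>.\<close>
      then have "\<bar>chebyshev_on a b k l\<bar> \<le> 1"
        using abs_chebyshev_on_le_1[of l a b k] abs_chebyshev_on_le[of a l b q k] l l_b ab q kappa
        by (cases "l \<le> a") (auto simp: c_def)
      with False show ?thesis by (simp add: l_def)
    qed
  qed
  have repr: "representable U" using U by (simp add: is_solution_def)
  \<comment> \<open>These measurability facts serve to split the integral of the sum at the
    end.\<close>
  have [measurable]: "fourier U \<in> borel_measurable borel"
    "fourier (\<lambda>y. U y - U\<^sub>\<delta> y) \<in> borel_measurable borel"
    using repr Udelta(1) by (simp_all add: borel_measurable_fourier representable_diff)
  have [measurable]: "N \<in> borel_measurable borel"
    unfolding N_def by (intro borel_measurable_continuous_onI continuous_on_norm linear_continuous_on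
        linear_conv_bounded_linear[THEN iffD1] matrix_vector_mul_linear)
  \<comment> \<open>The origin, excluded in \<open>P_le\<close>, is a null set.\<close>
  have "AE \<omega> in lborel. \<omega> \<noteq> (0::real^'n)" by (rule AE_lborel_singleton)
  with fourier_diff[OF repr Uk(1)] fourier_diff[OF repr Udelta(1)] Uk(2) Udelta(2)
  have "AE \<omega> in lborel. ennreal (N \<omega> powr s * cmod (fourier (\<lambda>y. U y - U\<^sub>k y) \<omega>))
      \<le> ennreal c * ennreal (N \<omega> powr s * cmod (fourier U \<omega>))
        + ennreal (N \<omega> powr s * cmod (fourier (\<lambda>y. U y - U\<^sub>\<delta> y) \<omega>))"
  proof eventually_elim
    case (elim \<omega>)
    let ?P = "\<bar>chebyshev_on a b k (1 / ((norm \<omega>)\<^sup>2 + \<mu>) * ((N \<omega>)\<^sup>2 + \<mu>))\<bar>"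
    have "cmod (fourier (\<lambda>y. U y - U\<^sub>k y) \<omega>) = ?P * cmod (fourier U \<omega>)"
      using elim(1,3) by (simp add: N_def norm_mult)
    also have "\<dots> \<le> (if (N \<omega>)\<^sup>2 > \<delta> * (norm \<omega>)\<^sup>2 then c else 1) * cmod (fourier U \<omega>)"
      using P_le[OF elim(5)] by (rule mult_right_mono) simp
    \<comment> \<open>Where the condition holds, the first summand is the bound itself. Elsewhere
      \<open>fourier U\<^sub>\<delta> \<omega> = 0\<close>, so the second summand equals
      \<open>cmod (fourier U \<omega>)\<close> and absorbs the factor 1.\<close>
    also have "\<dots> \<le> c * cmod (fourier U \<omega>) + cmod (fourier (\<lambda>y. U y - U\<^sub>\<delta> y) \<omega>)"
      using elim(2,4) \<open>c \<ge> 0\<close> by (simp add: N_def)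
    finally have "N \<omega> powr s * cmod (fourier (\<lambda>y. U y - U\<^sub>k y) \<omega>)
        \<le> N \<omega> powr s * (c * cmod (fourier U \<omega>) + cmod (fourier (\<lambda>y. U y - U\<^sub>\<delta> y) \<omega>))"
      by (rule mult_left_mono) simp
    also have "\<dots> = c * (N \<omega> powr s * cmod (fourier U \<omega>))
        + N \<omega> powr s * cmod (fourier (\<lambda>y. U y - U\<^sub>\<delta> y) \<omega>)"
      by (simp add: algebra_simps)
    finally show ?case
      using \<open>c \<ge> 0\<close> by (simp flip: ennreal_mult ennreal_plus)
  qed
  then have "snorm T s (\<lambda>y. U y - U\<^sub>k y)
      \<le> (\<integral>\<^sup>+\<omega>. ennreal c * ennreal (N \<omega> powr s * cmod (fourier U \<omega>))
          + ennreal (N \<omega> powr s * cmod (fourier (\<lambda>y. U y - U\<^sub>\<delta> y) \<omega>)) \<partial>lborel)"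
    unfolding snorm_def N_def by (rule nn_integral_mono_AE)
  also have "\<dots> = ennreal c * snorm T s U + snorm T s (\<lambda>y. U y - U\<^sub>\<delta> y)"
    unfolding snorm_def N_def[symmetric] by (subst nn_integral_add) (auto simp: nn_integral_cmult)
  finally show ?thesis by (simp add: c_def)
qed

end
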